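(* For every $n\ge 1$, let $P_n$ denote the number of pairs $(T,p)$ such that $T$ is a rooted tree with vertex set $[n]=\{1,\dots,n\}$ and $p\in[n]^n$ is a prime parking function on $T$. Then \[ P_n=(2n-2)!. \]
   Context: Let $T$ be a rooted tree with vertex set $[n]$, with all edges oriented towards the root (a labeled, unordered rooted tree; all such trees are counted). Given a sequence $s=(s_1,\dots,s_n)\in[n]^n$, drivers $1,2,\dots,n$ arrive in this order; driver $i$ goes to vertex $s_i$ and parks there if it is unoccupied, otherwise she follows the unique directed path towards the root and parks at the first unoccupied vertex; if there is none she leaves without parking. The pair $(T,s)$ is a parking function if all $n$ drivers park. For a vertex $v$, let $T_v$ be the set of vertices $u$ such that there is a directed path from $u$ to $v$ in $T$ (including $v$ itself). A parking function $(T,s)$ is prime if for every non-root vertex $v$ one has $|T_v|<|\{i: s_i\in T_v\}|$. *)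

theory Defs
  imports Main
begin

text \<open>A rooted labeled tree on vertex set {1..n} is encoded by its parent function
  par :: nat \<Rightarrow> nat: for a vertex v, par v is the next vertex on the directed edge
  towards the root; par v = 0 means v is the root. Outside {1..n}, par is 0 (canonical
  encoding so distinct trees correspond to distinct functions).\<close>

definition is_rooted_tree :: "nat \<Rightarrow> (nat \<Rightarrow> nat) \<Rightarrow> bool" where
  "is_rooted_tree n par \<longleftrightarrow>
     (\<forall>v. v \<notin> {1..n} \<longrightarrow> par v = 0) \<and>
     (\<forall>v\<in>{1..n}. par v \<le> n) \<and>
     (\<exists>!r. r \<in> {1..n} \<and> par r = 0) \<and>
     (\<forall>v\<in>{1..n}. \<exists>k. (par ^^ k) v = 0)"

definition park_spot :: "(nat \<Rightarrow> nat) \<Rightarrow> nat set \<Rightarrow> nat \<Rightarrow> nat option" where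
  "park_spot par Occ v =
     (if \<exists>k. (par ^^ k) v \<noteq> 0 \<and> (par ^^ k) v \<notin> Occ
      then Some ((par ^^ (LEAST k. (par ^^ k) v \<noteq> 0 \<and> (par ^^ k) v \<notin> Occ)) v)
      else None)"

definition park_step :: "(nat \<Rightarrow> nat) \<Rightarrow> nat set option \<Rightarrow> nat \<Rightarrow> nat set option" where
  "park_step par st v =
     (case st of None \<Rightarrow> None
      | Some Occ \<Rightarrow> (case park_spot par Occ v of None \<Rightarrow> None | Some u \<Rightarrow> Some (insert u Occ)))"

definition is_parking_function :: "(nat \<Rightarrow> nat) \<Rightarrow> nat list \<Rightarrow> bool" where
  "is_parking_function par s \<longleftrightarrow> foldl (park_step par) (Some {}) s \<noteq> None"

definition subtree :: "nat \<Rightarrow> (nat \<Rightarrow> nat) \<Rightarrow> nat \<Rightarrow> nat set" where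
  "subtree n par v = {u \<in> {1..n}. \<exists>k. (par ^^ k) u = v}"

definition is_prime_pf :: "nat \<Rightarrow> (nat \<Rightarrow> nat) \<Rightarrow> nat list \<Rightarrow> bool" where
  "is_prime_pf n par s \<longleftrightarrow> is_parking_function par s \<and>
     (\<forall>v\<in>{1..n}. par v \<noteq> 0 \<longrightarrow>
        card (subtree n par v) < card {i. i < length s \<and> s ! i \<in> subtree n par v})"

end

theory Submission
  imports Defs "HOL-Library.FuncSet"
    "HOL-Computational_Algebra.Formal_Power_Series"
begin

text \<open>
  The prime inequalities already force every driver to park, so only they matter. Let the last
  driver prefer \<open>u\<close>, and on the path from \<open>u\<close> to the root let \<open>c\<close> be the first vertex whose subtree
  contains exactly as many preferences of the other drivers as vertices. Cutting the edge above \<open>c\<close>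
  leaves a prime parking function on the subtree of \<open>c\<close>, the vertex \<open>u\<close> in it, and, once the last
  driver is redirected to the parent of \<open>c\<close>, a prime parking function on the remaining tree. The
  cut is reversible, so \<open>P\<^sub>n\<close> is the sum over \<open>0 < m < n\<close> of \<open>(n choose m) (n - 1 choose m) m P\<^sub>m P\<^sub>n\<^sub>-\<^sub>m\<close>,
  and \<open>n P\<^sub>n / n!\<^sup>2\<close> satisfies the Catalan recurrence.
\<close>

section \<open>Rooted trees on a finite vertex set\<close>

text \<open>The vertex set is an arbitrary set \<open>V\<close> because the cut leaves trees on
  \<open>A\<close> and on \<open>V - A\<close>, and the recursion has to apply to both.\<close>

definition subt :: "nat set \<Rightarrow> (nat \<Rightarrow> nat) \<Rightarrow> nat \<Rightarrow> nat set" where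
  "subt V par v = {u \<in> V. \<exists>k. (par ^^ k) u = v}"

text \<open>Reachability of \<open>r\<close> from every vertex rules out cycles. The number
  \<open>0\<close> stands for the place above the root; the value \<open>0\<close> outside
  \<open>V\<close> gives each tree a unique parent function, so that trees are counted as
  functions.\<close>

definition tree :: "nat set \<Rightarrow> nat \<Rightarrow> (nat \<Rightarrow> nat) \<Rightarrow> bool" where
  "tree V r par \<longleftrightarrow> 0 \<notin> V \<and> r \<in> V \<and> par r = 0 \<and> (\<forall>v. v \<notin> V \<longrightarrow> par v = 0) \<and>
     (\<forall>v\<in>V - {r}. par v \<in> V) \<and> subt V par r = V"

lemma subt_subset: "subt V par v \<subseteq> V"
  by (auto simp: subt_def)

lemma subt_self: "v \<in> V \<Longrightarrow> v \<in> subt V par v"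
  unfolding subt_def by (auto intro: exI[of _ 0])

lemma subt_child: "u \<in> V \<Longrightarrow> par u \<in> subt V par v \<Longrightarrow> u \<in> subt V par v"
  unfolding subt_def by (auto simp: funpow_swap1 intro: exI[of _ "Suc _"])

lemma subt_trans:
  assumes "u \<in> subt V par v" "v \<in> subt V par w" shows "u \<in> subt V par w"
proof -
  obtain j k where "(par ^^ j) u = v" "(par ^^ k) v = w"
    using assms by (auto simp: subt_def)
  then have "(par ^^ (k + j)) u = w"
    by (simp add: funpow_add)
  with assms show ?thesis
    unfolding subt_def by blast
qed

lemma funpow_zero_fixed: "par 0 = 0 \<Longrightarrow> (par ^^ k) 0 = 0" for par :: "nat \<Rightarrow> nat"
  by (induction k) auto

lemma treeD:
  assumes "tree V r par"
  shows "0 \<notin> V" "r \<in> V" "par r = 0" "v \<notin> V \<Longrightarrow> par v = 0"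
    "v \<in> V \<Longrightarrow> v \<noteq> r \<Longrightarrow> par v \<in> V" "subt V par r = V" "par 0 = 0"
  using assms by (auto simp: tree_def)

text \<open>The parent of the root is \<open>0\<close>, which \<open>par\<close> fixes, so the path
  from \<open>r\<close> never returns to \<open>V\<close>.\<close>

lemma root_in_subt:
  assumes "tree V r par" "v \<in> V" "r \<in> subt V par v" shows "v = r"
proof -
  obtain k where k: "(par ^^ k) r = v" using assms(3) by (auto simp: subt_def)
  show ?thesis
  proof (cases k)
    case (Suc j)
    then have "v = 0"
      using k treeD[OF assms(1)] by (simp add: funpow_swap1 funpow_zero_fixed)
    then show ?thesis using assms treeD(1) by blast
  qed (use k in auto)
qed

lemma subt_parent:
  assumes "tree V r par" "v \<in> V" "u \<in> subt V par v" "u \<noteq> v"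
  shows "par u \<in> subt V par v" "par u \<in> V" "u \<noteq> r"
proof -
  show ur: "u \<noteq> r" using root_in_subt assms by blast
  have uV: "u \<in> V" using assms(3) subt_subset by blast
  show pV: "par u \<in> V" using treeD(5)[OF assms(1) uV ur] .
  obtain k where k: "(par ^^ k) u = v" using assms(3) by (auto simp: subt_def)
  then obtain j where "k = Suc j" using assms(4) by (cases k) auto
  with k have "(par ^^ j) (par u) = v" by (simp add: funpow_swap1)
  with pV show "par u \<in> subt V par v" by (auto simp: subt_def)
qed

text \<open>Induction along the path from \<open>u\<close> to \<open>v\<close>, read from
  \<open>v\<close> downwards; most path arguments about trees take this form.\<close>

lemma subt_induct [consumes 3, case_names self step]:
  assumes tr: "tree V r par" and vV: "v \<in> V" and u: "u \<in> subt V par v"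
    and self: "P v"
    and step: "\<And>y. y \<in> subt V par v \<Longrightarrow> y \<noteq> v \<Longrightarrow> par y \<in> subt V par v \<Longrightarrow> P (par y) \<Longrightarrow> P y"
  shows "P u"
proof -
  obtain k where k: "(par ^^ k) u = v" using u by (auto simp: subt_def)
  show ?thesis using k u
  proof (induction k arbitrary: u)
    case (Suc k)
    show ?case
    proof (cases "u = v")
      case False
      then show ?thesis
        using Suc subt_parent[OF tr vV Suc.prems(2) False] step[of u]
        by (simp add: funpow_swap1)
    qed (use self in simp)
  qed (use self in simp)
qed

text \<open>If \<open>par c\<close> lay below \<open>c\<close>, no path could leave the subtree of
  \<open>c\<close>, yet every path leads to \<open>r\<close>, which lies outside it.\<close>

lemma parent_notin_subt:
  assumes tr: "tree V r par" and c: "c \<in> V" "c \<noteq> r"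
  shows "par c \<notin> subt V par c"
proof
  assume pc: "par c \<in> subt V par c"
  have "u \<notin> subt V par c" if "u \<in> subt V par r" for u
    using tr treeD(2)[OF tr] that
  proof (induction rule: subt_induct)
    case self show ?case using root_in_subt[OF tr c(1)] c(2) by blast
  next
    case (step y)
    then show ?case
      using pc subt_parent(1)[OF tr c(1), of y] by (cases "y = c") auto
  qed
  then show False using c(1) subt_self treeD(6)[OF tr] by blast
qed

text \<open>Two distinct vertices below each other would put \<open>par c\<close> below
  \<open>c\<close>.\<close>

lemma subt_antisym:
  assumes tr: "tree V r par" and "c \<in> subt V par v" "v \<in> subt V par c"
  shows "c = v"
proof (rule ccontr)
  assume "c \<noteq> v"
  have "c \<in> V" "v \<in> V" using assms subt_subset by blast+
  note p = subt_parent[OF tr \<open>v \<in> V\<close> assms(2) \<open>c \<noteq> v\<close>]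
  have "par c \<in> subt V par c" using p(1) assms(3) by (rule subt_trans)
  then show False using parent_notin_subt[OF tr \<open>c \<in> V\<close> p(3)] by blast
qed

text \<open>Both vertices lie on the single path starting at \<open>u\<close>, so the one reached
  first is below the other.\<close>

lemma subt_comparable:
  assumes "c \<in> V" "c' \<in> V" "u \<in> subt V par c" "u \<in> subt V par c'"
  shows "c \<in> subt V par c' \<or> c' \<in> subt V par c"
proof -
  obtain j k where j: "(par ^^ j) u = c" and k: "(par ^^ k) u = c'"
    using assms by (auto simp: subt_def)
  have "(par ^^ (k - j)) c = c'" if "j \<le> k"
    using that j k by (metis comp_apply funpow_add le_add_diff_inverse2)
  moreover have "(par ^^ (j - k)) c' = c" if "k \<le> j"
    using that j k by (metis comp_apply funpow_add le_add_diff_inverse2)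
  ultimately show ?thesis
    using assms(1,2) unfolding subt_def by (cases "j \<le> k") auto
qed

section \<open>Hanging one tree below a vertex of another, and cutting it off again\<close>

definition graft :: "nat set \<Rightarrow> nat \<Rightarrow> nat \<Rightarrow> (nat \<Rightarrow> nat) \<Rightarrow> (nat \<Rightarrow> nat) \<Rightarrow> nat \<Rightarrow> nat" where
  "graft A a w pA pC = (\<lambda>v. if v = a then w else if v \<in> A then pA v else pC v)"

context
  fixes A C a r w pA pC
  assumes trA: "tree A a pA" and trC: "tree C r pC" and disj: "A \<inter> C = {}" and w: "w \<in> C"
begin

private abbreviation "par \<equiv> graft A a w pA pC"

lemma graft_simps:
  "par a = w" "v \<in> A \<Longrightarrow> v \<noteq> a \<Longrightarrow> par v = pA v" "v \<in> C \<Longrightarrow> par v = pC v"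
  "v \<notin> A \<Longrightarrow> par v = pC v"
  using disj treeD(2)[OF trA] by (auto simp: graft_def)

lemma subt_mono_graft_left:
  assumes v: "v \<in> A" and u: "u \<in> subt A pA v" shows "u \<in> subt (A \<union> C) par v"
  using trA v u
proof (induction rule: subt_induct)
  case self show ?case using v by (simp add: subt_self)
next
  case (step y)
  have "y \<noteq> a" using subt_parent(3)[OF trA v step(1,2)] .
  moreover have "y \<in> A" using step(1) subt_subset by blast
  ultimately have "par y = pA y" by (simp add: graft_simps)
  then show ?case using step(4) \<open>y \<in> A\<close> by (intro subt_child[of y]) auto
qed

lemma subt_mono_graft_right:
  assumes v: "v \<in> C" and u: "u \<in> subt C pC v" shows "u \<in> subt (A \<union> C) par v"
  using trC v u
proof (induction rule: subt_induct)
  case self show ?case using v by (simp add: subt_self)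
next
  case (step y)
  have "y \<in> C" using step(1) subt_subset by blast
  then have "par y = pC y" by (simp add: graft_simps)
  then show ?case using step(4) \<open>y \<in> C\<close> by (intro subt_child[of y]) auto
qed

lemma tree_graft: "tree (A \<union> C) r par"
proof -
  have "v \<in> subt (A \<union> C) par r" if "v \<in> C" for v
    using subt_mono_graft_right treeD[OF trC] that by auto
  moreover have "v \<in> subt (A \<union> C) par r" if "v \<in> A" for v
  proof -
    have "v \<in> subt (A \<union> C) par a"
      using subt_mono_graft_left treeD[OF trA] that by auto
    moreover have "a \<in> subt (A \<union> C) par r"
      using calculation treeD(2)[OF trA] w \<open>\<And>v. v \<in> C \<Longrightarrow> v \<in> subt (A \<union> C) par r\<close>
      by (intro subt_child[of a]) (auto simp: graft_simps)
    ultimately show ?thesis by (rule subt_trans)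
  qed
  ultimately have "subt (A \<union> C) par r = A \<union> C"
    using subt_subset by blast
  then show ?thesis
    using trA trC disj w unfolding tree_def graft_def by auto
qed

text \<open>A path ending inside \<open>A\<close> can neither start in \<open>C\<close>, whose
  parents lie in \<open>C\<close> or are \<open>0\<close>, nor use the edge from \<open>a\<close> to
  \<open>w\<close>.\<close>

lemma subt_graft_left:
  assumes v: "v \<in> A" shows "subt (A \<union> C) par v = subt A pA v"
proof (intro equalityI subsetI)
  have vV: "v \<in> A \<union> C" using v by simp
  fix u assume "u \<in> subt (A \<union> C) par v"
  with tree_graft vV show "u \<in> subt A pA v"
  proof (induction rule: subt_induct)
    case self show ?case using v by (simp add: subt_self)
  next
    case (step y)
    have pyA: "par y \<in> A" using step(4) subt_subset by blast
    have "y \<in> A \<union> C" using step(1) subt_subset by blast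
    moreover have "y \<notin> C"
    proof
      assume "y \<in> C"
      then have "pC y \<in> A" using pyA by (simp add: graft_simps)
      then show False
        using \<open>y \<in> C\<close> disj treeD[OF trC] treeD(1)[OF trA] by (cases "y = r") auto
    qed
    moreover have "y \<noteq> a" using pyA w disj by (auto simp: graft_simps)
    ultimately show ?case using step(4) by (auto simp: graft_simps intro: subt_child[of y])
  qed
qed (use subt_mono_graft_left[OF v] in auto)

text \<open>Paths leave \<open>A\<close> only through the edge from \<open>a\<close> to
  \<open>w\<close>, so \<open>A\<close> joins a subtree as a whole, and exactly when that subtree
  contains \<open>w\<close>.\<close>

lemma subt_graft_right:
  assumes v: "v \<in> C"
  shows "subt (A \<union> C) par v = subt C pC v \<union> (if w \<in> subt C pC v then A else {})"
    (is "?L = ?R")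
proof (intro equalityI subsetI)
  have vV: "v \<in> A \<union> C" using v by simp
  fix u assume "u \<in> ?L"
  with tree_graft vV show "u \<in> ?R"
  proof (induction rule: subt_induct)
    case self show ?case using v by (simp add: subt_self)
  next
    case (step y)
    have yV: "y \<in> A \<union> C" using step(1) subt_subset by blast
    show ?case
    proof (cases "y \<in> C")
      case True
      then have "pC y \<in> C"
        using subt_parent[OF tree_graft vV step(1,2)] treeD[OF trC] by auto
      then have "pC y \<in> subt C pC v"
        using step(4) True disj by (auto simp: graft_simps split: if_splits)
      then show ?thesis using True by (auto intro: subt_child[of y])
    next
      case False
      then have yA: "y \<in> A" using yV by simp
      have "w \<in> subt C pC v"
      proof (cases "y = a")
        case True
        then show ?thesis using step(4) w disj by (auto simp: graft_simps split: if_splits)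
      next
        case False
        then have "par y \<in> A" using yA treeD[OF trA] by (auto simp: graft_simps)
        then have "par y \<notin> subt C pC v" using disj subt_subset by blast
        then show ?thesis using step(4) by (auto split: if_splits)
      qed
      then show ?thesis using yA by simp
    qed
  qed
next
  fix u assume u: "u \<in> ?R"
  show "u \<in> ?L"
  proof (cases "u \<in> subt C pC v")
    case False
    then have wv: "w \<in> subt C pC v" and uA: "u \<in> A" using u by (auto split: if_splits)
    have "par a \<in> ?L" using subt_mono_graft_right[OF v wv] by (simp add: graft_simps)
    then have "a \<in> ?L" using treeD(2)[OF trA] by (intro subt_child[of a]) auto
    moreover have "u \<in> subt (A \<union> C) par a"
      using subt_mono_graft_left uA treeD[OF trA] by auto
    ultimately show ?thesis using subt_trans by blast
  qed (use subt_mono_graft_right[OF v] in auto)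
qed

end

text \<open>Resetting \<open>pA\<close> and \<open>pC\<close> to \<open>0\<close> off their trees
  and \<open>pA\<close> at the new root keeps both parent functions canonical, so that grafting back
  gives an equality of functions.\<close>

lemma tree_cut:
  assumes tr: "tree V r par" and c: "c \<in> V" "c \<noteq> r"
  defines "A \<equiv> subt V par c"
  defines "pA \<equiv> \<lambda>v. if v \<in> A \<and> v \<noteq> c then par v else 0"
  defines "pC \<equiv> \<lambda>v. if v \<in> V - A then par v else 0"
  shows "tree A c pA" "tree (V - A) r pC" "par c \<in> V - A" "graft A c (par c) pA pC = par"
proof -
  have AV: "A \<subseteq> V" unfolding A_def by (rule subt_subset)
  have cA: "c \<in> A" unfolding A_def using c by (intro subt_self)
  have rA: "r \<notin> A" using root_in_subt[OF tr c(1)] c(2) unfolding A_def by blast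
  have root_reached: "u \<in> V \<Longrightarrow> u \<in> subt V par r" for u
    using treeD(6)[OF tr] by simp
  have "u \<in> subt A pA c" if "u \<in> A" for u
    using tr c(1) that[unfolded A_def]
  proof (induction rule: subt_induct)
    case self show ?case using cA by (rule subt_self)
  next
    case (step y)
    then have "y \<in> A" "pA y = par y" by (auto simp: A_def pA_def)
    then show ?case using step(4) by (auto intro: subt_child[of y])
  qed
  then have "subt A pA c = A" using subt_subset by blast
  then show "tree A c pA"
    using AV cA treeD(1)[OF tr] subt_parent(1)[OF tr c(1)] unfolding tree_def
    by (auto simp: pA_def A_def[symmetric])
  have up: "par y \<in> V - A" if "y \<in> V - A" "y \<noteq> r" for y
    using that treeD(5)[OF tr] subt_child[of y V par c] unfolding A_def by auto
  have "u \<in> V - A \<longrightarrow> u \<in> subt (V - A) pC r" if "u \<in> V" for u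
    using tr treeD(2)[OF tr] that[THEN root_reached]
  proof (induction rule: subt_induct)
    case self show ?case by (auto intro: subt_self)
  next
    case (step y)
    show ?case
    proof
      assume y: "y \<in> V - A"
      then have "pC y \<in> subt (V - A) pC r" using step up[OF y] by (simp add: pC_def)
      with y show "y \<in> subt (V - A) pC r" by (rule subt_child)
    qed
  qed
  then have "subt (V - A) pC r = V - A" using subt_subset by blast
  then show "tree (V - A) r pC"
    using rA up treeD(1-3)[OF tr] unfolding tree_def by (auto simp: pC_def)
  have pcV: "par c \<in> V" using treeD(5)[OF tr c] .
  have "par c \<notin> A"
    unfolding A_def using tr c by (rule parent_notin_subt)
  with pcV show "par c \<in> V - A" by simp
  show "graft A c (par c) pA pC = par"
    using treeD(4)[OF tr] AV by (auto simp: graft_def pA_def pC_def)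
qed

section \<open>Prime preferences\<close>

definition cnt :: "nat set \<Rightarrow> (nat \<Rightarrow> nat) \<Rightarrow> nat set \<Rightarrow> nat" where
  "cnt B s S = card {i \<in> B. s i \<in> S}"

definition prime_prefs :: "nat set \<Rightarrow> nat set \<Rightarrow> nat \<Rightarrow> (nat \<Rightarrow> nat) \<Rightarrow> (nat \<Rightarrow> nat) \<Rightarrow> bool" where
  "prime_prefs V B r par s \<longleftrightarrow>
     (\<forall>v\<in>V - {r}. card (subt V par v) < cnt B s (subt V par v))"

lemma cnt_cong: "(\<And>i. i \<in> B \<Longrightarrow> s i = s' i) \<Longrightarrow> cnt B s S = cnt B s' S"
  unfolding cnt_def by (rule arg_cong[where f = card]) auto

lemma prime_prefs_cong:
  "(\<And>i. i \<in> B \<Longrightarrow> s i = s' i) \<Longrightarrow> prime_prefs V B r par s = prime_prefs V B r par s'"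
  unfolding prime_prefs_def using cnt_cong[of B s s'] by simp

lemma cnt_Un: "finite B \<Longrightarrow> S \<inter> T = {} \<Longrightarrow> cnt B s (S \<union> T) = cnt B s S + cnt B s T"
  unfolding cnt_def by (subst card_Un_disjoint[symmetric]) (auto intro: arg_cong[where f = card])

lemma cnt_le: "finite B \<Longrightarrow> cnt B s S \<le> card B"
  unfolding cnt_def by (rule card_mono) auto

text \<open>A set closed under children splits into the disjoint subtrees of its topmost vertices,
  each of which has a surplus of preferences; the induction peels off one subtree at a time.\<close>

lemma prime_prefs_down_closed:
  assumes tr: "tree V r par" and fin: "finite V" "finite B" and pr: "prime_prefs V B r par s"
    and "S \<subseteq> V - {r}" "S \<noteq> {}" "\<And>y. y \<in> V \<Longrightarrow> par y \<in> S \<Longrightarrow> y \<in> S"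
  shows "card S < cnt B s S"
proof -
  have "finite S" using fin assms(5) finite_subset by blast
  then show ?thesis using assms(5-7)
  proof (induction S rule: finite_psubset_induct)
    case (psubset S)
    \<comment> \<open>Without a topmost vertex no path could leave \<open>S\<close>, and the root
      would be out of reach.\<close>
    have "\<exists>v\<in>S. par v \<notin> S"
    proof (rule ccontr)
      assume neg: "\<not> (\<exists>v\<in>S. par v \<notin> S)"
      have "u \<notin> S" if "u \<in> subt V par r" for u
        using tr treeD(2)[OF tr] that
      proof (induction rule: subt_induct)
        case self show ?case using psubset.prems by blast
      qed (use neg in blast)
      then show False using psubset.prems treeD(6)[OF tr] by blast
    qed
    then obtain v where v: "v \<in> S" "par v \<notin> S" by blast
    have vV: "v \<in> V" "v \<noteq> r" using v psubset.prems by auto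
    define T where "T = subt V par v"
    have "u \<in> S" if "u \<in> T" for u
      using tr vV(1) that[unfolded T_def]
    proof (induction rule: subt_induct)
      case (step y)
      then show ?case using psubset.prems(3) subt_subset by blast
    qed (use v in simp)
    then have TS: "T \<subseteq> S" by blast
    have vT: "v \<in> T" unfolding T_def using vV(1) by (rule subt_self)
    have cT: "card T < cnt B s T"
      using pr vV unfolding prime_prefs_def T_def by blast
    show ?case
    proof (cases "S - T = {}")
      case True
      then have "S = T" using TS by blast
      then show ?thesis using cT by simp
    next
      case False
      have "card (S - T) < cnt B s (S - T)"
      proof (rule psubset.IH)
        show "S - T \<subset> S" using vT TS by blast
        show "S - T \<subseteq> V - {r}" using psubset.prems by blast
        fix y assume y: "y \<in> V" "par y \<in> S - T"
        have "y \<notin> T"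
        proof
          assume "y \<in> T"
          moreover have "y \<noteq> v" using y v by blast
          ultimately have "par y \<in> T"
            using subt_parent(1)[OF tr vV(1)] unfolding T_def by blast
          then show False using y by blast
        qed
        then show "y \<in> S - T" using y psubset.prems(3) by blast
      qed (fact False)
      moreover have "cnt B s S = cnt B s (S - T) + cnt B s T"
        using cnt_Un[of B "S - T" T s] TS fin by (simp add: Un_absorb2 Int_commute)
      moreover have "card S = card (S - T) + card T"
        using TS psubset.hyps by (metis card_Diff_subset card_mono finite_subset le_add_diff_inverse2)
      ultimately show ?thesis using cT by linarith
    qed
  qed
qed

text \<open>In terms of parking, the edge leaving the cut vertex is the first edge crossed by driver \<open>b\<close>,
  arriving last, that nobody crossed before.\<close>

definition tight :: "nat set \<Rightarrow> nat set \<Rightarrow> nat \<Rightarrow> (nat \<Rightarrow> nat) \<Rightarrow> (nat \<Rightarrow> nat) \<Rightarrow> nat \<Rightarrow> bool" where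
  "tight V B b par s v \<longleftrightarrow> s b \<in> subt V par v \<and>
     card (subt V par v) = cnt (B - {b}) s (subt V par v)"

definition cut_vertex ::
  "nat set \<Rightarrow> nat set \<Rightarrow> nat \<Rightarrow> nat \<Rightarrow> (nat \<Rightarrow> nat) \<Rightarrow> (nat \<Rightarrow> nat) \<Rightarrow> nat \<Rightarrow> bool" where
  "cut_vertex V B b r par s c \<longleftrightarrow> c \<in> V - {r} \<and> tight V B b par s c \<and>
     (\<forall>v\<in>subt V par c. tight V B b par s v \<longrightarrow> v = c)"

text \<open>Tight vertices are ancestors of \<open>s b\<close>, hence comparable; the lower of two
  cut vertices is a tight vertex in the subtree of the other and so coincides with it.\<close>

lemma cut_vertex_unique:
  "cut_vertex V B b r par s c \<Longrightarrow> cut_vertex V B b r par s c' \<Longrightarrow> c = c'"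
  unfolding cut_vertex_def tight_def using subt_comparable[of c V c' "s b" par] by blast

text \<open>The subtree of each child of the root needs a surplus of at least one, but with as many
  drivers as vertices the total surplus outside the root is at most one. So the root has a single
  child \<open>d\<close>, which turns out to be tight, and a tight vertex with smallest subtree is a
  cut vertex.\<close>

lemma cut_vertex_exists:
  assumes tr: "tree V r par" and fin: "finite V" "finite B" and pr: "prime_prefs V B r par s"
    and card: "card V = card B" "2 \<le> card V" and b: "b \<in> B" and s: "\<And>i. i \<in> B \<Longrightarrow> s i \<in> V"
  shows "\<exists>c. cut_vertex V B b r par s c"
proof -
  have rV: "r \<in> V" using treeD(2)[OF tr] .
  have "\<exists>d\<in>V - {r}. par d = r"
  proof (rule ccontr)
    assume neg: "\<not> (\<exists>d\<in>V - {r}. par d = r)"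
    have "u = r" if "u \<in> subt V par r" for u
      using tr rV that
    proof (induction rule: subt_induct)
      case (step y)
      then show ?case using neg subt_subset by blast
    qed simp
    then have "V \<subseteq> {r}" using treeD(6)[OF tr] by blast
    then show False using card(2) card_mono[of "{r}" V] by simp
  qed
  then obtain d where d: "d \<in> V" "d \<noteq> r" "par d = r" by blast
  define T where "T = subt V par d"
  \<comment> \<open>\<open>R\<close> is the union of the subtrees of the other children of the root,
    to be shown empty.\<close>
  define R where "R = V - {r} - T"
  have rT: "r \<notin> T" using root_in_subt[OF tr d(1)] d(2) unfolding T_def by blast
  have TV: "T \<subseteq> V" unfolding T_def by (rule subt_subset)
  have cT: "card T < cnt B s T" using pr d unfolding prime_prefs_def T_def by blast
  have V_eq: "V = insert r (R \<union> T)" using rV TV unfolding R_def by blast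
  have RT: "R \<inter> T = {}" unfolding R_def by blast
  have fRT: "finite R" "finite T" using fin TV finite_subset unfolding R_def by auto
  have cV: "card V = Suc (card R + card T)"
  proof -
    have "card (R \<union> T) = card R + card T"
      using fRT RT by (rule card_Un_disjoint)
    moreover have "r \<notin> R \<union> T" using rT by (simp add: R_def)
    ultimately show ?thesis using fRT by (subst V_eq) simp
  qed
  have "cnt B s R + cnt B s T \<le> card B"
    using cnt_Un[OF fin(2) RT, of s] cnt_le[OF fin(2), of s "R \<union> T"] by simp
  moreover have "card R < cnt B s R" if "R \<noteq> {}"
  proof (rule prime_prefs_down_closed[OF tr fin pr])
    show "R \<subseteq> V - {r}" unfolding R_def by blast
    fix y assume y: "y \<in> V" "par y \<in> R"
    have "y \<noteq> r" using y treeD(1,3)[OF tr] unfolding R_def by auto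
    moreover have "y \<notin> T"
    proof
      assume "y \<in> T"
      moreover have "y \<noteq> d" using y d unfolding R_def by auto
      ultimately have "par y \<in> T" using subt_parent(1)[OF tr d(1)] unfolding T_def by blast
      then show False using y unfolding R_def by blast
    qed
    ultimately show "y \<in> R" using y unfolding R_def by blast
  qed (fact that)
  ultimately have R: "R = {}" using cV cT card(1) by fastforce
  \<comment> \<open>\<open>T\<close> has \<open>card B - 1\<close> vertices and needs strictly more
    preferences, so every driver prefers a vertex of \<open>T\<close>; leaving out \<open>b\<close>
    gives exactly \<open>card T\<close> preferences.\<close>
  then have "cnt B s T = card B" using cV cT card(1) cnt_le[OF fin(2), of s T] by simp
  then have "{i \<in> B. s i \<in> T} = B" unfolding cnt_def using fin
    by (intro card_subset_eq) auto
  then have sT: "s i \<in> T" if "i \<in> B" for i using that by blast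
  have "{i \<in> B - {b}. s i \<in> T} = B - {b}" using sT by blast
  then have "cnt (B - {b}) s T = card T"
    unfolding cnt_def using b fin card(1) cV R by simp
  then have "tight V B b par s d"
    using sT[OF b] unfolding tight_def T_def by simp
  then have "d \<in> V - {r} \<and> tight V B b par s d" using d by blast
  then obtain c where c: "c \<in> V - {r}" "tight V B b par s c"
    and least: "\<And>v. v \<in> V - {r} \<Longrightarrow> tight V B b par s v \<Longrightarrow>
      card (subt V par c) \<le> card (subt V par v)"
    using ex_has_least_nat[of "\<lambda>v. v \<in> V - {r} \<and> tight V B b par s v" d "\<lambda>v. card (subt V par v)"]
    by blast
  have "v = c" if v: "v \<in> subt V par c" "tight V B b par s v" for v
  proof (rule ccontr)
    assume "v \<noteq> c"
    have "c \<notin> subt V par v" using subt_antisym[OF tr] v(1) \<open>v \<noteq> c\<close> by blast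
    moreover have "subt V par v \<subseteq> subt V par c" using v(1) subt_trans by blast
    moreover have "c \<in> subt V par c" using c(1) by (auto intro: subt_self)
    ultimately have "subt V par v \<subset> subt V par c" by blast
    then have "card (subt V par v) < card (subt V par c)"
      using fin(1) by (meson finite_subset psubset_card_mono subt_subset)
    moreover have "v \<in> V - {r}"
      using subt_parent(3)[OF tr _ v(1) \<open>v \<noteq> c\<close>] c(1) v(1) subt_subset by blast
    ultimately show False using least[OF _ v(2)] by fastforce
  qed
  with c show ?thesis unfolding cut_vertex_def by blast
qed

text \<open>The inequalities correspond vertex by vertex. At \<open>v\<close> in \<open>A\<close>
  the whole tree may count \<open>b\<close> in addition to \<open>D\<close>, which changes the truth
  of the inequality only if \<open>v\<close> is tight, and this is excluded below the cut vertex. At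
  \<open>v\<close> in \<open>C\<close> with \<open>w\<close> in its subtree, the graft adds
  \<open>card A\<close> vertices and the equally many drivers of \<open>D\<close>, while
  \<open>b\<close> counts on both sides thanks to the redirection to \<open>w\<close>. At
  \<open>a\<close> itself the surplus is exactly one, due to \<open>b\<close>.\<close>

lemma prime_prefs_graft:
  assumes trA: "tree A a pA" and trC: "tree C r pC" and disj: "A \<inter> C = {}" and w: "w \<in> C"
    and fin: "finite A" "finite C" "finite B" and b: "b \<in> B"
    and D: "D = {i \<in> B - {b}. s i \<in> A}" and sb: "s b \<in> A" and cD: "card D = card A"
    and par: "par = graft A a w pA pC"
  shows "prime_prefs (A \<union> C) B r par s \<and> cut_vertex (A \<union> C) B b r par s a \<longleftrightarrow>
    prime_prefs A D a pA s \<and> prime_prefs C (B - D) r pC (s(b := w))"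
proof -
  let ?V = "A \<union> C"
  have aA: "a \<in> A" "r \<in> C" using trA trC treeD(2) by blast+
  have finD: "finite D" using D fin by simp
  have left: "subt ?V par v = subt A pA v" if "v \<in> A" for v
    using subt_graft_left[OF trA trC disj w that] par by simp
  have right: "subt ?V par v = subt C pC v \<union> (if w \<in> subt C pC v then A else {})" if "v \<in> C" for v
    using subt_graft_right[OF trA trC disj w that] par by simp
  have SA: "subt A pA a = A" using treeD(6)[OF trA] .
  have cnt_b: "cnt (B - {b}) s S = cnt D s S" if "S \<subseteq> A" for S
    unfolding cnt_def D using that by (intro arg_cong[where f = card]) auto
  have cnt_A: "cnt B s S = cnt D s S + (if s b \<in> S then 1 else 0)" if "S \<subseteq> A" for S
  proof -
    have eq: "{i \<in> B. s i \<in> S} = (if s b \<in> S then {b} else {}) \<union> {i \<in> D. s i \<in> S}"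
      unfolding D using that b by auto
    have "finite {i \<in> D. s i \<in> S}" "b \<notin> {i \<in> D. s i \<in> S}"
      by (rule finite_subset[OF _ finD]) (auto simp: D)
    then show ?thesis unfolding cnt_def eq by (cases "s b \<in> S") simp_all
  qed
  have cntD: "cnt D s A = card A" unfolding cD[symmetric] cnt_def D
    by (intro arg_cong[where f = card]) auto
  have tight: "tight ?V B b par s v \<longleftrightarrow> s b \<in> subt A pA v \<and> card (subt A pA v) = cnt D s (subt A pA v)"
    if "v \<in> A" for v
    unfolding tight_def left[OF that] using cnt_b[OF subt_subset] by simp
  have cut: "cut_vertex ?V B b r par s a \<longleftrightarrow>
     (\<forall>v\<in>A - {a}. \<not> (s b \<in> subt A pA v \<and> card (subt A pA v) = cnt D s (subt A pA v)))"
    unfolding cut_vertex_def left[OF aA(1)] SA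
    using tight aA disj SA sb cntD by auto
  have C_iff: "card (subt ?V par v) < cnt B s (subt ?V par v) \<longleftrightarrow>
      card (subt C pC v) < cnt (B - D) (s(b := w)) (subt C pC v)" if v: "v \<in> C" for v
  proof -
    define S where "S = subt C pC v"
    have SC: "S \<subseteq> C" unfolding S_def by (rule subt_subset)
    then have finS: "finite S" using fin finite_subset by blast
    show ?thesis
    proof (cases "w \<in> S")
      case True
      define E where "E = {i \<in> B - D. (s(b := w)) i \<in> S}"
      have "finite E" "E \<inter> D = {}" using fin(3) by (auto simp: E_def)
      moreover have "{i \<in> B. s i \<in> S \<union> A} = E \<union> D"
        using True b sb unfolding D E_def by auto
      ultimately have "cnt B s (S \<union> A) = cnt (B - D) (s(b := w)) S + card D"
        using finD by (simp only: cnt_def E_def[symmetric] card_Un_disjoint)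
      moreover have "card (S \<union> A) = card S + card A"
        using SC disj finS fin by (intro card_Un_disjoint) auto
      ultimately show ?thesis unfolding right[OF v] S_def[symmetric] using True cD by simp
    next
      case False
      \<comment> \<open>Driver \<open>b\<close> is counted on neither side: \<open>s b\<close> lies
        in \<open>A\<close>, and \<open>w\<close> lies outside \<open>S\<close>.\<close>
      have "{i \<in> B. s i \<in> S} = {i \<in> B - D. (s(b := w)) i \<in> S}"
        using False sb SC disj unfolding D by auto
      then show ?thesis unfolding right[OF v] S_def[symmetric] cnt_def using False by simp
    qed
  qed
  have A_iff: "card (subt ?V par v) < cnt B s (subt ?V par v) \<and>
      \<not> (s b \<in> subt A pA v \<and> card (subt A pA v) = cnt D s (subt A pA v)) \<longleftrightarrow>
      card (subt A pA v) < cnt D s (subt A pA v)" if "v \<in> A" for v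
    unfolding left[OF that] cnt_A[OF subt_subset] by auto
  have a_less: "card (subt ?V par a) < cnt B s (subt ?V par a)"
    unfolding left[OF aA(1)] SA cnt_A[OF subset_refl] using sb cntD by simp
  have "?V - {r} = insert a (A - {a}) \<union> (C - {r})" using aA disj by blast
  then have "prime_prefs ?V B r par s \<longleftrightarrow>
     (\<forall>v\<in>A - {a}. card (subt ?V par v) < cnt B s (subt ?V par v)) \<and>
     (\<forall>v\<in>C - {r}. card (subt ?V par v) < cnt B s (subt ?V par v))"
    unfolding prime_prefs_def using a_less by auto
  moreover have "prime_prefs C (B - D) r pC (s(b := w)) \<longleftrightarrow>
     (\<forall>v\<in>C - {r}. card (subt ?V par v) < cnt B s (subt ?V par v))"
    unfolding prime_prefs_def by (intro ball_cong refl C_iff[symmetric]) simp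
  moreover have "prime_prefs A D a pA s \<longleftrightarrow>
     (\<forall>v\<in>A - {a}. card (subt ?V par v) < cnt B s (subt ?V par v) \<and>
        \<not> (s b \<in> subt A pA v \<and> card (subt A pA v) = cnt D s (subt A pA v)))"
    unfolding prime_prefs_def by (intro ball_cong refl A_iff[symmetric]) simp
  ultimately show ?thesis unfolding cut ball_conj_distrib by argo
qed

section \<open>Counting prime parking functions\<close>

text \<open>Preferences are extensional functions on \<open>B\<close>, so that each choice is
  counted once. The root is carried along to be available in the decomposition; it is determined by
  \<open>par\<close>.\<close>

definition PPF :: "nat set \<Rightarrow> nat set \<Rightarrow> (nat \<times> (nat \<Rightarrow> nat) \<times> (nat \<Rightarrow> nat)) set" where
  "PPF V B = {(r, par, s). tree V r par \<and> s \<in> B \<rightarrow>\<^sub>E V \<and> prime_prefs V B r par s}"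

text \<open>The value \<open>sC b\<close>, overwritten here by \<open>u\<close>, is not lost: it
  becomes the parent of \<open>a\<close> in the grafted tree.\<close>

definition graft_prefs :: "nat set \<Rightarrow> nat \<Rightarrow> nat \<Rightarrow> (nat \<Rightarrow> nat) \<Rightarrow> (nat \<Rightarrow> nat) \<Rightarrow> nat \<Rightarrow> nat" where
  "graft_prefs D b u sA sC = (\<lambda>i. if i \<in> D then sA i else if i = b then u else sC i)"

text \<open>The map from pieces to the whole. The conclusions after the first two express every
  piece through the grafted pair and \<open>a\<close>, which yields injectivity once
  \<open>a\<close> is recognised as the cut vertex.\<close>

lemma graft_PPF:
  assumes fin: "finite V" "finite B" and b: "b \<in> B" and A: "A \<subseteq> V" and D: "D \<subseteq> B - {b}"
    and cD: "card D = card A" and ppA: "(a, pA, sA) \<in> PPF A D" and u: "u \<in> A"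
    and ppC: "(r, pC, sC) \<in> PPF (V - A) (B - D)"
  defines "par \<equiv> graft A a (sC b) pA pC" and "s \<equiv> graft_prefs D b u sA sC"
  shows "(r, par, s) \<in> PPF V B" "cut_vertex V B b r par s a" "A = subt V par a"
    "D = {i \<in> B - {b}. s i \<in> A}"
    "pA = (\<lambda>v. if v \<in> A \<and> v \<noteq> a then par v else 0)"
    "pC = (\<lambda>v. if v \<in> V - A then par v else 0)"
    "sA = restrict s D" "sC = restrict (s(b := par a)) (B - D)" "u = s b"
proof -
  have trA: "tree A a pA" and sA: "sA \<in> D \<rightarrow>\<^sub>E A" and prA: "prime_prefs A D a pA sA"
    using ppA by (auto simp: PPF_def)
  have trC: "tree (V - A) r pC" and sC: "sC \<in> (B - D) \<rightarrow>\<^sub>E (V - A)"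
    and prC: "prime_prefs (V - A) (B - D) r pC sC"
    using ppC by (auto simp: PPF_def)
  have VA: "A \<union> (V - A) = V" using A by blast
  have disj: "A \<inter> (V - A) = {}" by blast
  have w: "sC b \<in> V - A" using PiE_mem[OF sC, of b] b D by blast
  have sAD: "sA i \<in> A" if "i \<in> D" for i using PiE_mem[OF sA that] .
  have sCD: "sC i \<in> V - A" if "i \<in> B - D" for i using PiE_mem[OF sC that] .
  have aA: "a \<in> A" using treeD(2)[OF trA] .
  have sb: "s b = u" using D by (auto simp: s_def graft_prefs_def)
  then show "u = s b" ..
  \<comment> \<open>Drivers of \<open>D\<close> prefer vertices of \<open>A\<close>, all others
    except \<open>b\<close> prefer vertices of \<open>V - A\<close>, so the preferences reveal
    \<open>D\<close>.\<close>
  show D_eq: "D = {i \<in> B - {b}. s i \<in> A}"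
    using D sAD sCD by (auto simp: s_def graft_prefs_def)
  have para: "par a = sC b" by (simp add: par_def graft_def)
  show "sA = restrict s D"
  proof
    fix i show "sA i = restrict s D i"
      using PiE_arb[OF sA, of i] by (simp add: s_def graft_prefs_def)
  qed
  show "sC = restrict (s(b := par a)) (B - D)"
  proof
    fix i show "sC i = restrict (s(b := par a)) (B - D) i"
      using PiE_arb[OF sC, of i] by (auto simp: s_def graft_prefs_def para)
  qed
  show "pA = (\<lambda>v. if v \<in> A \<and> v \<noteq> a then par v else 0)"
    using treeD(3)[OF trA] treeD(4)[OF trA] by (auto simp: par_def graft_def fun_eq_iff)
  show "pC = (\<lambda>v. if v \<in> V - A then par v else 0)"
    using treeD(4)[OF trC] aA A by (auto simp: par_def graft_def fun_eq_iff)
  have tr: "tree V r par"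
    using tree_graft[OF trA trC disj w] unfolding VA par_def .
  show "A = subt V par a"
    using subt_graft_left[OF trA trC disj w aA] treeD(6)[OF trA] unfolding VA par_def by simp
  have "prime_prefs A D a pA s = prime_prefs A D a pA sA"
    by (rule prime_prefs_cong) (simp add: s_def graft_prefs_def)
  moreover have "prime_prefs (V - A) (B - D) r pC (s(b := sC b)) = prime_prefs (V - A) (B - D) r pC sC"
    by (rule prime_prefs_cong) (simp add: s_def graft_prefs_def)
  ultimately have *: "prime_prefs V B r par s \<and> cut_vertex V B b r par s a"
    using prime_prefs_graft[OF trA trC disj w _ _ _ b D_eq _ cD, of par] prA prC fin A u sb
    unfolding VA by (auto simp: par_def finite_subset)
  then show "cut_vertex V B b r par s a" by blast
  have "s \<in> B \<rightarrow>\<^sub>E V"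
  proof (rule PiE_I)
    fix i assume "i \<in> B"
    then show "s i \<in> V" using sAD sCD A u by (auto simp: s_def graft_prefs_def)
  next
    fix i assume "i \<notin> B"
    then show "s i = undefined" using D b PiE_arb[OF sC] by (auto simp: s_def graft_prefs_def)
  qed
  then show "(r, par, s) \<in> PPF V B" using tr * by (auto simp: PPF_def)
qed

text \<open>The inverse map, needed for surjectivity. The equality \<open>card A = card D\<close> is
  the tightness of \<open>a\<close>, and redirecting \<open>b\<close> to \<open>par a\<close>
  records in \<open>sC\<close> where \<open>A\<close> was attached.\<close>

lemma cut_PPF:
  assumes fin: "finite V" "finite B" and b: "b \<in> B" and pp: "(r, par, s) \<in> PPF V B"
    and cut: "cut_vertex V B b r par s a"
  defines "A \<equiv> subt V par a"
  defines "D \<equiv> {i \<in> B - {b}. s i \<in> A}"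
  defines "pA \<equiv> \<lambda>v. if v \<in> A \<and> v \<noteq> a then par v else 0"
    and "pC \<equiv> \<lambda>v. if v \<in> V - A then par v else 0"
    and "sA \<equiv> restrict s D" and "sC \<equiv> restrict (s(b := par a)) (B - D)"
  shows "(a, pA, sA) \<in> PPF A D" "(r, pC, sC) \<in> PPF (V - A) (B - D)" "s b \<in> A"
    "par = graft A a (sC b) pA pC" "s = graft_prefs D b (s b) sA sC" "card A = card D"
proof -
  have tr: "tree V r par" and s: "s \<in> B \<rightarrow>\<^sub>E V" and pr: "prime_prefs V B r par s"
    using pp by (auto simp: PPF_def)
  have a: "a \<in> V" "a \<noteq> r" using cut by (auto simp: cut_vertex_def)
  have AV: "A \<subseteq> V" unfolding A_def by (rule subt_subset)
  have VA: "A \<union> (V - A) = V" using AV by blast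
  have disj: "A \<inter> (V - A) = {}" by blast
  note cuts = tree_cut[OF tr a, folded A_def, folded pA_def pC_def]
  have sCb: "sC b = par a" using b by (simp add: sC_def D_def)
  show sb: "s b \<in> A" and cAD: "card A = card D"
    using cut by (auto simp: cut_vertex_def tight_def cnt_def A_def D_def)
  show "par = graft A a (sC b) pA pC" using cuts(4) sCb by simp
  show "s = graft_prefs D b (s b) sA sC"
    using PiE_arb[OF s] b by (intro ext) (auto simp: graft_prefs_def sA_def sC_def)
  have "prime_prefs A D a pA s \<and> prime_prefs (V - A) (B - D) r pC (s(b := par a))"
    using prime_prefs_graft[OF cuts(1,2) disj cuts(3) _ _ fin(2) b, of D s par] sb fin AV cAD pr cut
      cuts(4)
    unfolding VA by (auto simp: D_def finite_subset)
  moreover have "prime_prefs A D a pA s = prime_prefs A D a pA sA"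
    by (rule prime_prefs_cong) (simp add: sA_def)
  moreover have "prime_prefs (V - A) (B - D) r pC (s(b := par a)) = prime_prefs (V - A) (B - D) r pC sC"
    by (rule prime_prefs_cong) (simp add: sC_def)
  moreover have "sA \<in> D \<rightarrow>\<^sub>E A" unfolding sA_def D_def by auto
  moreover have "sC \<in> (B - D) \<rightarrow>\<^sub>E (V - A)"
    unfolding sC_def using PiE_mem[OF s] cuts(3) by (auto simp: D_def split: if_splits)
  ultimately show "(a, pA, sA) \<in> PPF A D" "(r, pC, sC) \<in> PPF (V - A) (B - D)"
    using cuts(1,2) by (auto simp: PPF_def)
qed

text \<open>The index set displays the recurrence: with \<open>n = card V\<close> there are
  \<open>n choose m\<close> sets \<open>A\<close>, \<open>n - 1 choose m\<close> sets
  \<open>D\<close> avoiding \<open>b\<close>, and \<open>m\<close> choices of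
  \<open>u\<close>.\<close>

lemma PPF_bij:
  assumes fin: "finite V" "finite B" and b: "b \<in> B" and card: "card V = card B" "2 \<le> card V"
  shows "bij_betw (\<lambda>(m, A, D, (a, pA, sA), u, (r, pC, sC)).
      (r, graft A a (sC b) pA pC, graft_prefs D b u sA sC))
    (SIGMA m:{1..<card V}. SIGMA A:{A. A \<subseteq> V \<and> card A = m}.
      SIGMA D:{D. D \<subseteq> B - {b} \<and> card D = m}. PPF A D \<times> A \<times> PPF (V - A) (B - D))
    (PPF V B)" (is "bij_betw ?f ?Y _")
  unfolding bij_betw_def
proof (intro conjI equalityI subsetI)
  show "inj_on ?f ?Y"
  proof (intro inj_onI)
    fix x y assume x: "x \<in> ?Y" and y: "y \<in> ?Y" and eq: "?f x = ?f y"
    obtain m A D a pA sA u r pC sC where x_eq: "x = (m, A, D, (a, pA, sA), u, (r, pC, sC))"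
      by (metis prod_cases3)
    obtain m' A' D' a' pA' sA' u' r' pC' sC'
      where y_eq: "y = (m', A', D', (a', pA', sA'), u', (r', pC', sC'))"
      by (metis prod_cases3)
    define par s where "par = graft A a (sC b) pA pC" and "s = graft_prefs D b u sA sC"
    have eqs: "r' = r" "graft A' a' (sC' b) pA' pC' = par" "graft_prefs D' b u' sA' sC' = s"
      using eq unfolding x_eq y_eq par_def s_def by auto
    have *: "cut_vertex V B b r par s a" "A = subt V par a"
      "D = {i \<in> B - {b}. s i \<in> A}"
      "pA = (\<lambda>v. if v \<in> A \<and> v \<noteq> a then par v else 0)"
      "pC = (\<lambda>v. if v \<in> V - A then par v else 0)"
      "sA = restrict s D" "sC = restrict (s(b := par a)) (B - D)" "u = s b"
      using graft_PPF[OF fin b, of A D a pA sA u r pC sC] x unfolding x_eq par_def s_def by auto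
    have **: "cut_vertex V B b r par s a'" "A' = subt V par a'"
      "D' = {i \<in> B - {b}. s i \<in> A'}"
      "pA' = (\<lambda>v. if v \<in> A' \<and> v \<noteq> a' then par v else 0)"
      "pC' = (\<lambda>v. if v \<in> V - A' then par v else 0)"
      "sA' = restrict s D'" "sC' = restrict (s(b := par a')) (B - D')" "u' = s b"
      using graft_PPF[OF fin b, of A' D' a' pA' sA' u' r' pC' sC'] y
      unfolding y_eq eqs by auto
    \<comment> \<open>Both are cut vertices of the same grafted pair; every other piece is a
      function of that pair and \<open>a\<close>.\<close>
    have a: "a' = a" using cut_vertex_unique[OF **(1) *(1)] .
    have A: "A' = A" using *(2) **(2) a by simp
    have D: "D' = D" using *(3) **(3) A by simp
    have "pA' = pA" unfolding *(4) **(4) a A ..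
    moreover have "pC' = pC" unfolding *(5) **(5) A ..
    moreover have "sA' = sA" unfolding *(6) **(6) D ..
    moreover have "sC' = sC" unfolding *(7) **(7) D a ..
    moreover have "u' = u" unfolding *(8) **(8) ..
    moreover have "m' = m" using x y A unfolding x_eq y_eq by auto
    ultimately show "x = y" unfolding x_eq y_eq eqs(1) a A D by simp
  qed
next
  fix z assume "z \<in> ?f ` ?Y"
  then show "z \<in> PPF V B" using graft_PPF(1)[OF fin b] by auto
next
  fix z assume z: "z \<in> PPF V B"
  obtain r par s where z_eq: "z = (r, par, s)" by (rule prod_cases3)
  have pp: "(r, par, s) \<in> PPF V B" using z z_eq by simp
  have tr: "tree V r par" and pr: "prime_prefs V B r par s" and s: "s \<in> B \<rightarrow>\<^sub>E V"
    using pp by (auto simp: PPF_def)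
  obtain a where cut: "cut_vertex V B b r par s a"
    using cut_vertex_exists[OF tr fin pr card b] s by blast
  define A D where "A = subt V par a" and "D = {i \<in> B - {b}. s i \<in> subt V par a}"
  define pA pC where "pA = (\<lambda>v. if v \<in> A \<and> v \<noteq> a then par v else 0)"
    and "pC = (\<lambda>v. if v \<in> V - A then par v else 0)"
  define sA sC where "sA = restrict s D" and "sC = restrict (s(b := par a)) (B - D)"
  note c = cut_PPF[OF fin b pp cut, folded A_def D_def, folded D_def pA_def pC_def sA_def sC_def]
  have AV: "A \<subseteq> V" unfolding A_def by (rule subt_subset)
  \<comment> \<open>The index \<open>m = card A\<close> is in range: the root is outside
    \<open>A\<close>, and \<open>s b\<close> is inside.\<close>
  have "r \<notin> A" using root_in_subt[OF tr, of a] cut unfolding cut_vertex_def A_def by blast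
  then have "A \<subset> V" using AV treeD(2)[OF tr] by blast
  then have "card A < card V" using fin by (simp add: psubset_card_mono)
  moreover have "card A \<noteq> 0" using c(3) finite_subset[OF AV fin(1)] by auto
  ultimately have "(card A, A, D, (a, pA, sA), s b, (r, pC, sC)) \<in> ?Y"
    using c AV by (auto simp: D_def)
  moreover have "z = ?f (card A, A, D, (a, pA, sA), s b, (r, pC, sC))"
    using c(4,5) z_eq by simp
  ultimately show "z \<in> ?f ` ?Y" by (rule image_eqI[rotated])
qed

lemma PPF_singleton:
  assumes "v \<noteq> 0"
  shows "PPF {v} {b} = {(v, \<lambda>_. 0, \<lambda>i\<in>{b}. v)}"
proof -
  have "tree {v} v (\<lambda>_. 0)"
    using assms subt_self[of v "{v}" "\<lambda>_. 0"] subt_subset[of "{v}" "\<lambda>_. 0" v] unfolding tree_def by auto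
  then have "(v, \<lambda>_. 0, \<lambda>i\<in>{b}. v) \<in> PPF {v} {b}"
    by (auto simp: PPF_def prime_prefs_def)
  moreover have "x = (v, \<lambda>_. 0, \<lambda>i\<in>{b}. v)" if "x \<in> PPF {v} {b}" for x
  proof -
    obtain r par s where x: "x = (r, par, s)" by (rule prod_cases3)
    with that have tr: "tree {v} r par" and s: "s \<in> {b} \<rightarrow>\<^sub>E {v}" by (auto simp: PPF_def)
    have "r = v" using treeD(2)[OF tr] by simp
    moreover have "par = (\<lambda>_. 0)"
    proof
      fix i show "par i = 0"
        using treeD(3)[OF tr] treeD(4)[OF tr, of i] \<open>r = v\<close> by (cases "i = v") simp_all
    qed
    moreover have "s = (\<lambda>i\<in>{b}. v)"
    proof
      fix i show "s i = (\<lambda>i\<in>{b}. v) i"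
        using PiE_mem[OF s, of i] PiE_arb[OF s, of i] by (cases "i = b") auto
    qed
    ultimately show ?thesis using x by simp
  qed
  ultimately show ?thesis by blast
qed

section \<open>The Catalan recurrence and the resulting count\<close>

text \<open>The Catalan number \<open>fact (2 * m) / (fact m * fact (Suc m))\<close> as a
  coefficient of the binomial series with exponent \<open>1/2\<close>, which opens the way to the
  Vandermonde convolution.\<close>

lemma fact_double_half_gchoose:
  "fact (2 * m) = (-1) ^ m / 2 * 4 ^ Suc m * fact (Suc m) * fact m * ((1/2 :: real) gchoose Suc m)"
proof (induction m)
  case (Suc m)
  define g where "g = (1/2 :: real) gchoose Suc m"
  define g' where "g' = (1/2 :: real) gchoose Suc (Suc m)"
  have "(1/2) * g = real (Suc m) * g + real (Suc (Suc m)) * g'"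
    unfolding g_def g'_def by (rule gbinomial_mult_1)
  \<comment> \<open>The ratio of consecutive coefficients absorbs the odd factor
    \<open>2 * m + 1\<close> of the next factorial.\<close>
  then have "- (2 * real m + 1) * g = 2 * (real m + 2) * g'"
    by (simp add: algebra_simps)
  define h where "h = (-1 :: real) ^ m / 2 * 4 ^ Suc m * fact (Suc m) * fact m"
  have "fact (2 * Suc m) = (2 * real m + 2) * (2 * real m + 1) * fact (2 * m)"
    by (simp add: algebra_simps)
  also have "\<dots> = (2 * real m + 2) * (2 * real m + 1) * (h * g)"
    unfolding Suc.IH g_def h_def ..
  also have "\<dots> = - h * (2 * real m + 2) * (- (2 * real m + 1) * g)"
    by algebra
  also have "\<dots> = - h * (2 * real m + 2) * (2 * (real m + 2) * g')"
    by (simp only: \<open>- (2 * real m + 1) * g = 2 * (real m + 2) * g'\<close>)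
  also have "\<dots> = 4 * (- h) * (real m + 2) * (real m + 1) * g'"
    by algebra
  also have "4 * (- h) * (real m + 2) * (real m + 1) =
      (-1) ^ Suc m / 2 * 4 ^ Suc (Suc m) * ((real m + 2) * fact (Suc m)) * ((real m + 1) * fact m)"
  proof -
    have "4 * (- (q / 2 * p * f * e)) * (x + 2) * (x + 1) =
        - 1 * q / 2 * (4 * p) * ((x + 2) * f) * ((x + 1) * e)" for q p f e x :: real
      by simp
    then show ?thesis unfolding h_def power_Suc .
  qed
  also have "(real m + 2) * fact (Suc m) = fact (Suc (Suc m))"
    unfolding fact_Suc[of "Suc m"] by (simp del: fact_Suc)
  also have "(real m + 1) * fact m = fact (Suc m)"
    unfolding fact_Suc[of m] by simp
  finally show ?case unfolding g'_def .
qed simp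

text \<open>Up to the factor \<open>n! (n - 1)!\<close> this is the Catalan recurrence, read off from the coefficient of
  \<open>x\<^sup>n\<close> in the square of \<open>\<surd>(1 - 4x)\<close>, which is \<open>0\<close>.\<close>

lemma catalan_convolution:
  assumes "2 \<le> n"
  shows "(\<Sum>m\<in>{1..<n}. (n choose m) * ((n - 1 choose m) *
     (fact (2 * m - 2) * (m * fact (2 * (n - m) - 2))))) = fact (2 * n - 2)"
    (is "(\<Sum>m\<in>_. ?t m) = _")
proof -
  let ?g = "\<lambda>m. (1/2 :: real) gchoose m"
  \<comment> \<open>\<open>K\<close> collects what does not depend on \<open>m\<close>. With
    \<open>m = i + 1\<close> and \<open>n - m = j + 1\<close> the signs multiply to
    \<open>(-1) ^ (i + j) = (-1) ^ n\<close>, the powers of \<open>4\<close> to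
    \<open>4 ^ n\<close>, and the two halves to \<open>1/4\<close>.\<close>
  define K :: real where "K = fact n * fact (n - 1) * (-1) ^ n * 4 ^ n / 4"
  have term_eq: "real (?t m) = K * (?g m * ?g (n - m))" if m: "m \<in> {1..<n}" for m
  proof -
    obtain i where i: "m = Suc i" using m by (cases m) auto
    obtain j where j: "n = Suc (Suc (i + j))" using m i by (auto dest!: less_imp_Suc_add)
    have bin: "real (n choose m) = fact n / (fact (Suc i) * fact (Suc j))"
      "real (n - 1 choose m) = fact (n - 1) / (fact (Suc i) * fact j)"
      using m binomial_fact[of m n, where 'a = real] binomial_fact[of m "n - 1", where 'a = real]
      by (simp_all add: i j del: fact_Suc binomial_Suc_Suc)
    have "real (?t m) = real (n choose m) * (real (n - 1 choose m) *
        (fact (2 * i) * (real (Suc i) * fact (2 * j))))"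
      unfolding of_nat_mult by (simp add: i j del: binomial_Suc_Suc)
    also have "\<dots> = fact n / (fact (Suc i) * fact (Suc j)) * (fact (n - 1) / (fact (Suc i) * fact j) *
        (((-1) ^ i / 2 * 4 ^ Suc i * fact (Suc i) * fact i * ?g (Suc i)) *
         (real (Suc i) * ((-1) ^ j / 2 * 4 ^ Suc j * fact (Suc j) * fact j * ?g (Suc j)))))"
      unfolding bin fact_double_half_gchoose[of i] fact_double_half_gchoose[of j] ..
    also have "\<dots> = fact n * fact (n - 1) * ((-1) ^ (i + j) * 4 ^ n / 4) *
        (real (Suc i) * fact i / fact (Suc i)) * (?g (Suc i) * ?g (Suc j))"
      by (simp add: j power_add del: fact_Suc)
    also have "real (Suc i) * fact i / fact (Suc i) = (1 :: real)"
      unfolding fact_Suc[of i, symmetric] by (simp del: fact_Suc)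
    finally show ?thesis by (simp add: K_def i j)
  qed
  \<comment> \<open>The exponents add up to \<open>1\<close>, and \<open>1 + x\<close> has no term
    of degree \<open>n \<ge> 2\<close>.\<close>
  have "(\<Sum>m = 0..n. ?g m * ?g (n - m)) = (1/2 + 1/2) gchoose n"
    by (rule gbinomial_Vandermonde)
  also have "\<dots> = real (1 choose n)"
    using binomial_gbinomial[of 1 n, where 'a = real] by simp
  also have "\<dots> = 0" using assms by simp
  finally have "(\<Sum>m = 0..n. ?g m * ?g (n - m)) = 0" .
  \<comment> \<open>The terms for \<open>m = 0\<close> and \<open>m = n\<close> both equal
    \<open>?g n\<close>, which leaves \<open>- 2 * ?g n\<close> for the rest.\<close>
  moreover have "{0..n} = insert 0 (insert n {1..<n})" using assms by auto
  ultimately have conv: "(\<Sum>m\<in>{1..<n}. ?g m * ?g (n - m)) = - 2 * ?g n"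
    using assms by simp
  obtain k where k: "n = Suc k" using assms by (cases n) auto
  have "real (\<Sum>m\<in>{1..<n}. ?t m) = K * (\<Sum>m\<in>{1..<n}. ?g m * ?g (n - m))"
    unfolding of_nat_sum sum_distrib_left by (intro sum.cong refl term_eq)
  also have "\<dots> = K * (- 2 * ?g n)" by (simp only: conv)
  \<comment> \<open>For \<open>n = k + 1\<close> the factor \<open>- 2 * K\<close> is the one in the
    closed form of \<open>fact (2 * k)\<close>.\<close>
  also have "\<dots> = fact (2 * k)"
    unfolding fact_double_half_gchoose[of k] K_def k by simp
  finally have "real (\<Sum>m\<in>{1..<n}. ?t m) = real (fact (2 * n - 2))"
    by (simp add: k)
  then show ?thesis by (simp only: of_nat_eq_iff)
qed

theorem card_PPF:
  assumes "finite V" "finite B" "card V = card B" "V \<noteq> {}" "0 \<notin> V"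
  shows "card (PPF V B) = fact (2 * card V - 2)"
  using assms
proof (induction "card V" arbitrary: V B rule: less_induct)
  case less
  define n where "n = card V"
  note fin = less.prems(1,2)
  have nz: "card V \<noteq> 0" using less.prems(1,4) by (simp add: card_eq_0_iff)
  then have "B \<noteq> {}" using less.prems(3) by auto
  then obtain b where b: "b \<in> B" by blast
  show ?case
  proof (cases "2 \<le> card V")
    case False
    with nz have "card V = 1" by linarith
    then obtain v c where "V = {v}" "B = {c}"
      using less.prems(3) by (metis card_1_singletonE)
    moreover have "v \<noteq> 0" using less.prems(5) \<open>V = {v}\<close> by auto
    ultimately show ?thesis using PPF_singleton by simp
  next
    case True
    let ?P = "\<lambda>m. fact (2 * m - 2) :: nat"
    have sub: "card (PPF A D) = ?P m \<and> finite (PPF A D) \<and>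
        card (PPF (V - A) (B - D)) = ?P (n - m) \<and> finite (PPF (V - A) (B - D)) \<and> finite A"
      if "m \<in> {1..<n}" "A \<subseteq> V" "card A = m" "D \<subseteq> B - {b}" "card D = m" for A D m
    proof -
      have "finite A" "finite D"
        using that finite_subset[of A V] finite_subset[of D B] fin by auto
      have cards: "card (V - A) = n - m" "card (B - D) = n - m"
        using that fin less.prems(3) card_Diff_subset[of A V] card_Diff_subset[of D B]
          \<open>finite A\<close> \<open>finite D\<close>
        by (auto simp: n_def)
      have "A \<noteq> {}" "V - A \<noteq> {}" using cards that by auto
      have "card (PPF A D) = ?P m"
        using less.hyps[of A D] \<open>A \<noteq> {}\<close> \<open>finite A\<close> \<open>finite D\<close> less.prems(5) that
        by (auto simp: n_def)
      moreover have "card (PPF (V - A) (B - D)) = ?P (n - m)"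
        using less.hyps[of "V - A" "B - D"] \<open>V - A \<noteq> {}\<close> cards fin less.prems(5) that
        by (auto simp: n_def)
      \<comment> \<open>Finiteness comes from the count itself: a factorial is positive, and
        infinite sets have \<open>card\<close> equal to \<open>0\<close>.\<close>
      ultimately show ?thesis using \<open>finite A\<close> by (metis card_ge_0_finite fact_gt_zero)
    qed
    let ?As = "\<lambda>m. {A. A \<subseteq> V \<and> card A = m}" and ?Ds = "\<lambda>m. {D. D \<subseteq> B - {b} \<and> card D = m}"
    let ?P3 = "\<lambda>A D. PPF A D \<times> A \<times> PPF (V - A) (B - D)"
    let ?Y = "\<lambda>m. SIGMA A:?As m. SIGMA D:?Ds m. ?P3 A D"
    have finI: "finite (?As m)" "finite (?Ds m)" for m using fin by auto
    have fin3: "finite (?P3 A D)" if "m \<in> {1..<n}" "A \<in> ?As m" "D \<in> ?Ds m" for m A D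
      using sub[OF that(1), of A D] that(2,3) by (intro finite_cartesian_product) blast+
    have fin2: "finite (SIGMA D:?Ds m. ?P3 A D)" if "m \<in> {1..<n}" "A \<in> ?As m" for m A
      by (rule finite_SigmaI[OF finI(2) fin3[OF that]])
    have fin1: "finite (?Y m)" if "m \<in> {1..<n}" for m
      by (rule finite_SigmaI[OF finI(1) fin2[OF that]])
    have "card (PPF V B) = card (SIGMA m:{1..<n}. ?Y m)"
      using bij_betw_same_card[OF PPF_bij[OF fin b less.prems(3) True]] by (simp only: n_def)
    also have "\<dots> = (\<Sum>m\<in>{1..<n}. card (?Y m))"
      by (rule card_SigmaI) (simp, use fin1 in blast)
    also have "\<dots> = (\<Sum>m\<in>{1..<n}. \<Sum>A\<in>?As m.
        card (SIGMA D:?Ds m. ?P3 A D))"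
      by (rule sum.cong[OF refl], rule card_SigmaI[OF finI(1)]) (use fin2 in blast)
    also have "\<dots> = (\<Sum>m\<in>{1..<n}. \<Sum>A\<in>?As m. \<Sum>D\<in>?Ds m. card (?P3 A D))"
      by (rule sum.cong[OF refl], rule sum.cong[OF refl], rule card_SigmaI[OF finI(2)])
        (use fin3 in blast)
    also have "\<dots> = (\<Sum>m\<in>{1..<n}. \<Sum>A\<in>?As m. \<Sum>D\<in>?Ds m.
        card (PPF A D) * (card A * card (PPF (V - A) (B - D))))"
      by (simp only: card_cartesian_product)
    also have "\<dots> = (\<Sum>m\<in>{1..<n}. \<Sum>A\<in>{A. A \<subseteq> V \<and> card A = m}.
        \<Sum>D\<in>{D. D \<subseteq> B - {b} \<and> card D = m}. ?P m * (m * ?P (n - m)))"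
      using sub by (intro sum.cong refl) auto
    also have "\<dots> = (\<Sum>m\<in>{1..<n}. (n choose m) * ((n - 1 choose m) * (?P m * (m * ?P (n - m)))))"
      using fin b less.prems(3) by (simp add: n_subsets n_def)
    also have "\<dots> = ?P n" using True by (intro catalan_convolution) (simp add: n_def)
    finally show ?thesis by (simp add: n_def)
  qed
qed

section \<open>Prime conditions force every driver to park\<close>

lemma park_spot_SomeD:
  assumes "park_spot par Occ x = Some u"
  obtains k where "u = (par ^^ k) x" "u \<noteq> 0" "u \<notin> Occ"
    "\<And>j. j < k \<Longrightarrow> (par ^^ j) x \<noteq> 0 \<Longrightarrow> (par ^^ j) x \<in> Occ"
proof -
  let ?Q = "\<lambda>k. (par ^^ k) x \<noteq> 0 \<and> (par ^^ k) x \<notin> Occ"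
  have ex: "\<exists>k. ?Q k" and u: "u = (par ^^ (LEAST k. ?Q k)) x"
    using assms by (auto simp: park_spot_def split: if_splits)
  have "?Q (LEAST k. ?Q k)" using LeastI_ex[OF ex] .
  moreover have "\<not> ?Q j" if "j < (LEAST k. ?Q k)" for j using not_less_Least[OF that] .
  ultimately show ?thesis using that[of "LEAST k. ?Q k"] u by blast
qed

lemma park_step_eq_Some:
  "park_step par st x = Some Occ \<longleftrightarrow>
     (\<exists>Occ' u. st = Some Occ' \<and> park_spot par Occ' x = Some u \<and> Occ = insert u Occ')"
  by (auto simp: park_step_def split: option.splits)

text \<open>The exits of \<open>S\<close> being unoccupied, no driver has left \<open>S\<close>.\<close>

lemma parked_ge_prefs:
  assumes tr: "tree V r par" and fin: "finite V" and s: "set s \<subseteq> V"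
    and "foldl (park_step par) (Some {}) s = Some Occ"
  shows "Occ \<subseteq> V \<and> card Occ = length s \<and>
    (\<forall>S\<subseteq>V. (\<forall>v\<in>S. par v \<notin> S \<longrightarrow> v \<notin> Occ) \<longrightarrow>
       card {i. i < length s \<and> s ! i \<in> S} \<le> card (Occ \<inter> S))"
  using s assms(4)
proof (induction s arbitrary: Occ rule: rev_induct)
  case Nil
  then show ?case by simp
next
  case (snoc x s)
  from snoc.prems(2) obtain Occ' u where fold: "foldl (park_step par) (Some {}) s = Some Occ'"
    and spot: "park_spot par Occ' x = Some u" and Occ: "Occ = insert u Occ'"
    by (auto simp: park_step_eq_Some)
  have "set s \<subseteq> V" using snoc.prems(1) by simp
  note IH' = snoc.IH[OF this fold]
  have IH: "Occ' \<subseteq> V" "card Occ' = length s"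
    "\<And>S. S \<subseteq> V \<Longrightarrow> \<forall>v\<in>S. par v \<notin> S \<longrightarrow> v \<notin> Occ' \<Longrightarrow>
       card {i. i < length s \<and> s ! i \<in> S} \<le> card (Occ' \<inter> S)"
    using IH' by simp_all
  have finO: "finite Occ'" using finite_subset[OF IH(1) fin] .
  have xV: "x \<in> V" using snoc.prems(1) by simp
  obtain k where k: "u = (par ^^ k) x" "u \<noteq> 0" "u \<notin> Occ'"
    "\<And>j. j < k \<Longrightarrow> (par ^^ j) x \<noteq> 0 \<Longrightarrow> (par ^^ j) x \<in> Occ'"
    using park_spot_SomeD[OF spot] by blast
  have path: "(par ^^ j) x \<in> insert 0 V" for j
  proof (induction j)
    case (Suc j)
    then show ?case
      using treeD(3)[OF tr] treeD(5)[OF tr, of "(par ^^ j) x"] treeD(7)[OF tr]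
      by (cases "(par ^^ j) x = r") auto
  qed (use xV in simp)
  have uV: "u \<in> V" using path[of k] k by auto
  have "card {i. i < length (s @ [x]) \<and> (s @ [x]) ! i \<in> S} \<le> card (Occ \<inter> S)"
    if S: "S \<subseteq> V" and ex: "\<forall>v\<in>S. par v \<notin> S \<longrightarrow> v \<notin> Occ" for S
  proof -
    have IHS: "card {i. i < length s \<and> s ! i \<in> S} \<le> card (Occ' \<inter> S)"
      using ex Occ by (intro IH(3) S) auto
    have eq: "{i. i < length (s @ [x]) \<and> (s @ [x]) ! i \<in> S} =
        {i. i < length s \<and> s ! i \<in> S} \<union> (if x \<in> S then {length s} else {})"
      by (auto simp: nth_append less_Suc_eq)
    show ?thesis
    proof (cases "x \<in> S")
      case True
      \<comment> \<open>The driver passes occupied vertices only, and none of these is an exit of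
        \<open>S\<close>. So she parks in \<open>S\<close>, and the newly occupied vertex offsets
        her preference.\<close>
      have "(par ^^ j) x \<in> S" if "j \<le> k" for j
        using that
      proof (induction j)
        case (Suc j)
        then have jS: "(par ^^ j) x \<in> S" by simp
        then have "(par ^^ j) x \<in> V" using S by blast
        then have "(par ^^ j) x \<noteq> 0" using treeD(1)[OF tr] by (intro notI) simp
        then have "(par ^^ j) x \<in> Occ'" using k(4)[of j] Suc.prems by simp
        with jS show ?case using ex Occ by auto
      qed (use True in simp)
      then have "u \<in> S" using k(1) by blast
      then have "Occ \<inter> S = insert u (Occ' \<inter> S)" using Occ by blast
      then have "card (Occ \<inter> S) = Suc (card (Occ' \<inter> S))" using k(3) finO by simp
      moreover have "card {i. i < length (s @ [x]) \<and> (s @ [x]) ! i \<in> S} \<le>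
          Suc (card {i. i < length s \<and> s ! i \<in> S})"
        unfolding eq using True by (simp add: card_insert_if)
      ultimately show ?thesis using IHS by linarith
    next
      case False
      have "card (Occ' \<inter> S) \<le> card (Occ \<inter> S)"
        using finO Occ by (intro card_mono) auto
      then show ?thesis using IHS False unfolding eq by simp
    qed
  qed
  then show ?case using IH(1,2) uV k(3) finO Occ by simp
qed

text \<open>Suppose driver \<open>t\<close> finds no place, and let \<open>S\<close> be the set of
  vertices whose path to the root meets an unoccupied vertex. All \<open>card V - t\<close> free
  places lie in \<open>S\<close>, so \<open>card S = card (Occ \<inter> S) + card V - t\<close>. But
  at most \<open>card (Occ \<inter> S)\<close> of the drivers before \<open>t\<close> prefer
  \<open>S\<close>, driver \<open>t\<close> does not, and only \<open>card V - t - 1\<close> drivers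
  follow, so \<open>S\<close> has fewer preferences than vertices, against the prime
  inequalities.\<close>

lemma prime_prefs_imp_parking:
  assumes tr: "tree V r par" and fin: "finite V" and s: "set s \<subseteq> V" and len: "length s = card V"
    and pr: "prime_prefs V {..<length s} r par (\<lambda>i. s ! i)"
  shows "is_parking_function par s"
proof -
  have "foldl (park_step par) (Some {}) (take t s) \<noteq> None" if "t \<le> length s" for t
    using that
  proof (induction t)
    case (Suc t)
    then have t: "t < length s" by simp
    with Suc obtain Occ where Occ: "foldl (park_step par) (Some {}) (take t s) = Some Occ" by auto
    have "set (take t s) \<subseteq> V" using s set_take_subset by fastforce
    note parked = parked_ge_prefs[OF tr fin this Occ]
    let ?x = "s ! t"
    have xV: "?x \<in> V" using s t by auto
    have "park_spot par Occ ?x \<noteq> None"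
    proof
      assume "park_spot par Occ ?x = None"
      then have full: "(par ^^ k) ?x \<in> insert 0 Occ" for k
        by (auto simp: park_spot_def split: if_splits)
      \<comment> \<open>This set avoids the root, is closed under children and has unoccupied exits,
        so both \<open>prime_prefs_down_closed\<close> and \<open>parked_ge_prefs\<close> apply to
        it.\<close>
      define S where "S = {y \<in> V. \<exists>k. (par ^^ k) y \<in> V - Occ}"
      have SV: "S \<subseteq> V" by (auto simp: S_def)
      have "(par ^^ k) ?x \<notin> V - Occ" for k using full[of k] treeD(1)[OF tr] by auto
      then have "?x \<notin> S" unfolding S_def by simp
      obtain k where k: "(par ^^ k) ?x = r"
        using xV treeD(6)[OF tr] by (auto simp: subt_def)
      have "(par ^^ j) r \<notin> V - Occ" for j
        using full[of "j + k"] k treeD(1)[OF tr] by (auto simp: funpow_add)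
      then have "r \<notin> S" unfolding S_def by simp
      have down: "y \<in> S" if "y \<in> V" "par y \<in> S" for y
      proof -
        obtain k where "(par ^^ k) (par y) \<in> V - Occ" using \<open>par y \<in> S\<close> by (auto simp: S_def)
        then have "(par ^^ Suc k) y \<in> V - Occ" by (simp add: funpow_swap1)
        then show ?thesis using that(1) unfolding S_def by blast
      qed
      have exits: "v \<notin> Occ" if v: "v \<in> S" "par v \<notin> S" for v
      proof
        assume "v \<in> Occ"
        obtain k where k: "(par ^^ k) v \<in> V - Occ" using v by (auto simp: S_def)
        \<comment> \<open>The free vertex is not \<open>v\<close> itself, so it already lies on the
          path from \<open>par v\<close>.\<close>
        then obtain j where j: "k = Suc j" using \<open>v \<in> Occ\<close> by (cases k) auto
        have "v \<noteq> r" using v \<open>r \<notin> S\<close> by blast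
        then have "par v \<in> V" using treeD(5)[OF tr] v SV by blast
        moreover have "(par ^^ j) (par v) \<in> V - Occ" using k j by (simp add: funpow_swap1)
        ultimately show False using v(2) unfolding S_def by blast
      qed
      have fins: "finite S" "finite Occ" using finite_subset fin SV parked by blast+
      have "V - Occ \<subseteq> S" by (auto simp: S_def intro!: exI[of _ 0])
      then have "V = S \<union> Occ" using SV parked by blast
      moreover have "S \<union> Occ = S \<union> (Occ - S)" by blast
      ultimately have cV: "card V = card S + card (Occ - S)"
        using fins by (metis Diff_disjoint card_Un_disjoint finite_Diff)
      have cO: "card Occ = card (Occ \<inter> S) + card (Occ - S)"
        using fins by (metis card_Int_Diff)
      have tl: "length (take t s) = t" using t by simp
      have "{i. i < t \<and> take t s ! i \<in> S} = {i. i < t \<and> s ! i \<in> S}" by auto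
      then have early: "card {i. i < t \<and> s ! i \<in> S} \<le> card (Occ \<inter> S)"
        using parked SV exits unfolding tl by metis
      have "{i. i < length s \<and> s ! i \<in> S} \<subseteq> {i. i < t \<and> s ! i \<in> S} \<union> {t<..<length s}"
        using \<open>?x \<notin> S\<close> by (auto, metis linorder_neqE_nat)
      then have "card {i. i < length s \<and> s ! i \<in> S} \<le>
          card ({i. i < t \<and> s ! i \<in> S} \<union> {t<..<length s})"
        by (rule card_mono[rotated]) auto
      also have "\<dots> \<le> card {i. i < t \<and> s ! i \<in> S} + (length s - Suc t)"
        using card_Un_le[of "{i. i < t \<and> s ! i \<in> S}" "{t<..<length s}"] by simp
      finally have late: "card {i. i < length s \<and> s ! i \<in> S} \<le> card (Occ \<inter> S) + (length s - Suc t)"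
        using early by linarith
      have "card S \<le> cnt {..<length s} (\<lambda>i. s ! i) S"
      proof (cases "S = {}")
        case False
        then show ?thesis
          using prime_prefs_down_closed[OF tr fin _ pr, of S] SV \<open>r \<notin> S\<close> down
          by (auto intro: less_imp_le)
      qed simp
      also have "\<dots> = card {i. i < length s \<and> s ! i \<in> S}"
        unfolding cnt_def by (intro arg_cong[where f = card]) auto
      finally show False using late cV cO len parked t tl by linarith
    qed
    then show ?case using Occ t by (auto simp: take_Suc_conv_app_nth park_step_eq_Some)
  qed simp
  from this[of "length s"] show ?thesis by (simp add: is_parking_function_def)
qed

section \<open>Transfer to parent functions and preference lists on \<open>{1..n}\<close>\<close>

text \<open>Since \<open>r\<close> is the only vertex sent to \<open>0\<close>, a path from a vertex
  to \<open>0\<close> passes through \<open>r\<close>; conversely one more step from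
  \<open>r\<close> reaches \<open>0\<close>.\<close>

lemma is_rooted_tree_iff: "is_rooted_tree n par \<longleftrightarrow> (\<exists>r. tree {1..n} r par)"
proof
  assume t: "is_rooted_tree n par"
  then obtain r where r: "r \<in> {1..n}" "par r = 0"
    and uniq: "\<And>v. v \<in> {1..n} \<Longrightarrow> par v = 0 \<Longrightarrow> v = r"
    unfolding is_rooted_tree_def by blast
  have out: "\<And>v. v \<notin> {1..n} \<Longrightarrow> par v = 0" and le: "\<And>v. v \<in> {1..n} \<Longrightarrow> par v \<le> n"
    and zero: "\<And>v. v \<in> {1..n} \<Longrightarrow> \<exists>k. (par ^^ k) v = 0"
    using t unfolding is_rooted_tree_def by blast+
  have step: "par v \<in> {1..n}" if "v \<in> {1..n} - {r}" for v
    using that uniq[of v] le[of v] by fastforce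
  have "\<exists>j. (par ^^ j) v = r" if "(par ^^ k) v = 0" "v \<in> {1..n}" for k v
    using that
  proof (induction k arbitrary: v)
    case (Suc k)
    show ?case
    proof (cases "v = r")
      case True
      then show ?thesis using funpow_0 by metis
    next
      case False
      then have "par v \<in> {1..n}" using step Suc.prems by blast
      moreover have "(par ^^ k) (par v) = 0" using Suc.prems by (simp add: funpow_swap1)
      ultimately obtain j where "(par ^^ j) (par v) = r" using Suc.IH by blast
      then have "(par ^^ Suc j) v = r" by (simp add: funpow_swap1)
      then show ?thesis by blast
    qed
  qed simp
  then have "subt {1..n} par r = {1..n}" using zero unfolding subt_def by blast
  then have "tree {1..n} r par" using r out step unfolding tree_def by simp
  then show "\<exists>r. tree {1..n} r par" ..
next
  assume "\<exists>r. tree {1..n} r par"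
  then obtain r where tr: "tree {1..n} r par" ..
  have le: "par v \<le> n" if "v \<in> {1..n}" for v
    using treeD(3)[OF tr] treeD(5)[OF tr that] by (cases "v = r") auto
  have uniq: "v = r" if "v \<in> {1..n}" "par v = 0" for v
    using treeD(1)[OF tr] treeD(5)[OF tr that(1)] that(2) by metis
  have zero: "\<exists>k. (par ^^ k) v = 0" if v: "v \<in> {1..n}" for v
  proof -
    have "v \<in> subt {1..n} par r" using treeD(6)[OF tr] v by simp
    then obtain k where "(par ^^ k) v = r" unfolding subt_def by blast
    then have "(par ^^ Suc k) v = 0" using treeD(3)[OF tr] by simp
    then show ?thesis by blast
  qed
  show "is_rooted_tree n par"
    unfolding is_rooted_tree_def
    using treeD(2,3)[OF tr] treeD(4)[OF tr] le uniq zero by blast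
qed

lemma tree_root_unique:
  assumes "tree V r par" "tree V r' par" shows "r' = r"
proof (rule ccontr)
  assume "r' \<noteq> r"
  then have "par r' \<in> V" using treeD(5)[OF assms(1)] treeD(2)[OF assms(2)] by blast
  then show False using treeD(1,3)[OF assms(2)] by simp
qed

text \<open>\<open>prime_prefs_imp_parking\<close> supplies the parking clause; what remains is to
  match the inequalities, where \<open>par v \<noteq> 0\<close> singles out the non-root
  vertices.\<close>

lemma is_prime_pf_iff:
  assumes tr: "tree {1..n} r par" and len: "length s = n" and s: "set s \<subseteq> {1..n}"
  shows "is_prime_pf n par s \<longleftrightarrow> prime_prefs {1..n} {..<n} r par (\<lambda>i. s ! i)"
proof -
  have "par v \<noteq> 0 \<longleftrightarrow> v \<noteq> r" if "v \<in> {1..n}" for v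
    using treeD(1)[OF tr] treeD(3)[OF tr] treeD(5)[OF tr that] by metis
  then have "prime_prefs {1..n} {..<n} r par (\<lambda>i. s ! i) \<longleftrightarrow>
     (\<forall>v\<in>{1..n}. par v \<noteq> 0 \<longrightarrow>
        card (subtree n par v) < card {i. i < length s \<and> s ! i \<in> subtree n par v})"
    unfolding prime_prefs_def cnt_def subtree_def subt_def len by auto
  moreover have "is_parking_function par s" if "prime_prefs {1..n} {..<n} r par (\<lambda>i. s ! i)"
    using prime_prefs_imp_parking[OF tr _ s] that len by simp
  ultimately show ?thesis unfolding is_prime_pf_def by blast
qed

theorem theorem1p3:
  fixes n :: nat
  assumes "n \<ge> 1"
  shows "card {(par, s). is_rooted_tree n par \<and> length s = n \<and> set s \<subseteq> {1..n}
                 \<and> is_prime_pf n par s} = fact (2 * n - 2)"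
proof -
  \<comment> \<open>Drivers are the list positions \<open>0\<close> to \<open>n - 1\<close>. The map
    tabulates the preferences as a list and forgets the root; this loses nothing by
    \<open>tree_root_unique\<close>.\<close>
  let ?f = "\<lambda>(r, par, s). (par, map s [0..<n])"
  let ?X = "PPF {1..n} {..<n}"
  let ?Y = "{(par, s). is_rooted_tree n par \<and> length s = n \<and> set s \<subseteq> {1..n}
                 \<and> is_prime_pf n par s}"
  have cong: "prime_prefs {1..n} {..<n} r par s = prime_prefs {1..n} {..<n} r par s'"
    if "\<And>i. i < n \<Longrightarrow> s i = s' i" for r par s s'
    using that by (intro prime_prefs_cong) auto
  have "bij_betw ?f ?X ?Y"
    unfolding bij_betw_def
  proof (intro conjI equalityI subsetI)
    show "inj_on ?f ?X"
    proof (rule inj_onI)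
      fix x y assume x: "x \<in> ?X" and y: "y \<in> ?X" and eq: "?f x = ?f y"
      obtain r par s where x_eq: "x = (r, par, s)" by (rule prod_cases3)
      obtain r' par' s' where y_eq: "y = (r', par', s')" by (rule prod_cases3)
      have "par' = par" and map: "map s [0..<n] = map s' [0..<n]"
        using eq unfolding x_eq y_eq by auto
      have "r' = r"
        using x y tree_root_unique unfolding x_eq y_eq \<open>par' = par\<close> PPF_def by blast
      have "s \<in> {..<n} \<rightarrow>\<^sub>E {1..n}" "s' \<in> {..<n} \<rightarrow>\<^sub>E {1..n}"
        using x y unfolding x_eq y_eq PPF_def by auto
      then have "s = s'" by (rule PiE_ext) (use map in auto)
      then show "x = y" unfolding x_eq y_eq \<open>par' = par\<close> \<open>r' = r\<close> by simp
    qed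
  next
    fix z assume "z \<in> ?f ` ?X"
    then obtain r par s where z: "z = (par, map s [0..<n])" and pp: "(r, par, s) \<in> ?X" by auto
    have tr: "tree {1..n} r par" and s: "s \<in> {..<n} \<rightarrow>\<^sub>E {1..n}"
      and pr: "prime_prefs {1..n} {..<n} r par s"
      using pp by (auto simp: PPF_def)
    have sub: "set (map s [0..<n]) \<subseteq> {1..n}" using PiE_mem[OF s] by auto
    have "is_prime_pf n par (map s [0..<n])"
      using pr cong[of "\<lambda>i. map s [0..<n] ! i" s] is_prime_pf_iff[OF tr _ sub] by simp
    then show "z \<in> ?Y" using z tr sub is_rooted_tree_iff by auto
  next
    fix z assume "z \<in> ?Y"
    then obtain par s where z: "z = (par, s)" and t: "is_rooted_tree n par"
      and len: "length s = n" and sub: "set s \<subseteq> {1..n}" and pf: "is_prime_pf n par s" by auto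
    obtain r where tr: "tree {1..n} r par" using t is_rooted_tree_iff by blast
    \<comment> \<open>The restriction makes the preimage \<open>undefined\<close> off
      \<open>{..<n}\<close>, as membership in \<open>PPF\<close> demands.\<close>
    let ?s = "\<lambda>i\<in>{..<n}. s ! i"
    have "prime_prefs {1..n} {..<n} r par ?s"
      using pf is_prime_pf_iff[OF tr len sub] cong[of ?s "\<lambda>i. s ! i"] by simp
    moreover have "?s \<in> {..<n} \<rightarrow>\<^sub>E {1..n}"
      using sub len by (auto simp: subset_iff)
    ultimately have "(r, par, ?s) \<in> ?X" using tr by (simp add: PPF_def)
    moreover have "z = ?f (r, par, ?s)"
      unfolding z by (simp add: list_eq_iff_nth_eq len)
    ultimately show "z \<in> ?f ` ?X" by (rule image_eqI[rotated])
  qed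
  then have "card ?Y = card ?X" by (simp add: bij_betw_same_card)
  also have "\<dots> = fact (2 * n - 2)" using card_PPF[of "{1..n}" "{..<n}"] assms by simp
  finally show ?thesis .
qed

end
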